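(* Let $w(x_1,\dots,x_t)$ be an outer commutator. Then, in any group, the number of finite-index subgroups which are maximal (by inclusion) among all normal subgroups satisfying the identity $w(x_1,\dots,x_t)=1$ is finite. Moreover, for every positive integer $n$, the number of such subgroups of index $\le n$ does not exceed $$2^{F^{t-1}(n)},$$ where $F^k(x)$ is the $k$-th iteration of the function $F(x)=x\,n^{2^x}$.
   Context: Outer commutators: let $F(x_1,x_2,\dots)$ be a free group of countable rank. An outer commutator of weight $1$ is a letter $x_i$. An outer commutator of weight $t>1$ is a word of the form $w(x_1,\dots,x_t)=[u(x_1,\dots,x_r),v(x_{r+1},\dots,x_t)]$, where $u$ and $v$ are outer commutators of weights $r$ and $t-r$, respectively (so all letters occurring are different). The subgroups counted are those subgroups of finite index that are maximal elements, with respect to inclusion, of the set of all normal subgroups of the group satisfying the identity $w=1$. *)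

theory Defs
  imports "HOL-Algebra.Algebra"
begin

text \<open>
  Elements of the free group on \<open>x\<^sub>0, x\<^sub>1, \<dots>\<close>, written as words in signed letters:
  \<open>(i, True)\<close> is the letter with index \<open>i\<close> and \<open>(i, False)\<close> is its inverse. No cancellation is
  imposed in \<open>word_comm\<close>: the words it is applied to in \<open>outer_commutator\<close> are nonempty and have no
  letter in common, so every outer commutator is already a freely reduced word.
\<close>

type_synonym group_word = "(nat \<times> bool) list"

definition word_inv :: "group_word \<Rightarrow> group_word" where
  "word_inv u = rev (map (\<lambda>(i, e). (i, \<not> e)) u)"

definition word_comm :: "group_word \<Rightarrow> group_word \<Rightarrow> group_word" where
  "word_comm u v = word_inv u @ word_inv v @ u @ v"

definition letters :: "group_word \<Rightarrow> nat set" where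
  "letters u = fst ` set u"

inductive outer_commutator :: "nat \<Rightarrow> group_word \<Rightarrow> bool" where
  letter: "outer_commutator 1 [(i, True)]"
| comm: "outer_commutator (r + s) (word_comm u v)"
    if "outer_commutator r u" and "outer_commutator s v" and "letters u \<inter> letters v = {}"

primrec word_eval :: "('a, 'b) monoid_scheme \<Rightarrow> (nat \<Rightarrow> 'a) \<Rightarrow> group_word \<Rightarrow> 'a" where
  "word_eval H \<rho> [] = \<one>\<^bsub>H\<^esub>"
| "word_eval H \<rho> (a # u) =
     (if snd a then \<rho> (fst a) else inv\<^bsub>H\<^esub> (\<rho> (fst a))) \<otimes>\<^bsub>H\<^esub> word_eval H \<rho> u"

definition satisfies_identity :: "('a, 'b) monoid_scheme \<Rightarrow> group_word \<Rightarrow> bool" where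
  "satisfies_identity H w \<longleftrightarrow> (\<forall>\<rho>. (\<forall>i. \<rho> i \<in> carrier H) \<longrightarrow> word_eval H \<rho> w = \<one>\<^bsub>H\<^esub>)"

definition normal_subgroups_satisfying ::
    "('a, 'b) monoid_scheme \<Rightarrow> group_word \<Rightarrow> 'a set set" where
  "normal_subgroups_satisfying G w =
     {N. N \<lhd> G \<and> satisfies_identity (G\<lparr>carrier := N\<rparr>) w}"

definition maximal_finite_index ::
    "('a, 'b) monoid_scheme \<Rightarrow> group_word \<Rightarrow> 'a set set" where
  "maximal_finite_index G w =
     {N \<in> normal_subgroups_satisfying G w.
        (\<forall>M \<in> normal_subgroups_satisfying G w. N \<subseteq> M \<longrightarrow> M = N) \<and>
        finite (rcosets\<^bsub>G\<^esub> N)}"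

end

theory Submission
  imports Defs
begin

text \<open>
  The values of an outer commutator behave multilinearly on normal subgroups: \<open>w\<close> vanishes on
  \<open>A\<^sub>1 \<times> \<dots> \<times> B C \<times> \<dots> \<times> A\<^sub>t\<close> as soon as it vanishes with \<open>B\<close> and with \<open>C\<close> in place of
  the product (\<open>word_values_set_mult_slot\<close>). Expanding all slots reduces the vanishing of \<open>w\<close> on
  \<open>N Z\<close> to its vanishing on all mixtures of \<open>N\<close> and \<open>Z\<close> (\<open>word_values_set_mult\<close>).

  Let \<open>\<M>\<close> be a nonempty family of normal finite-index subgroups satisfying \<open>w = 1\<close>. Say that \<open>Z\<close>
  is good at level \<open>j\<close> (\<open>mixed_vanishing\<close>) if \<open>w\<close> vanishes whenever at least \<open>j\<close> slots hold \<open>Z\<close> and all the others hold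
  one and the same member of \<open>\<M>\<close>. Any member of \<open>\<M>\<close> is good at level \<open>t\<close>. A normal finite-index
  subgroup \<open>Z\<close> that is good at level \<open>j + 1\<close> can be shrunk to one that is good at level \<open>j\<close>
  (\<open>mixed_vanishing_step\<close>): with \<open>j\<close> slots inside \<open>Z\<close>, the other slots matter only modulo \<open>Z\<close>, so
  it suffices to intersect \<open>Z\<close> with one representative of each of the at most \<open>2^\<bar>G/Z\<bar>\<close> classes
  \<open>N Z\<close>. If the members of \<open>\<M>\<close> have index at most \<open>n\<close>, the index grows from \<open>x\<close> to at
  most \<open>F(x) = x n^(2^x)\<close>, so after \<open>t - 1\<close> steps a subgroup \<open>Z\<close> of index at most \<open>F\<^sup>t\<^sup>-\<^sup>1(n)\<close>
  is good at level \<open>1\<close>.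

  For such a \<open>Z\<close> every \<open>N Z\<close> with \<open>N \<in> \<M>\<close> satisfies \<open>w = 1\<close>. If the members of \<open>\<M>\<close> are
  maximal, this forces \<open>Z \<subseteq> N\<close>, and there are at most \<open>2^\<bar>G/Z\<bar>\<close> subgroups above \<open>Z\<close>.
\<close>

section \<open>Commutators modulo a normal subgroup\<close>

definition commutator :: "('a, 'b) monoid_scheme \<Rightarrow> 'a \<Rightarrow> 'a \<Rightarrow> 'a" where
  "commutator G g h = inv\<^bsub>G\<^esub> g \<otimes>\<^bsub>G\<^esub> (inv\<^bsub>G\<^esub> h \<otimes>\<^bsub>G\<^esub> (g \<otimes>\<^bsub>G\<^esub> h))"

lemma (in group) inv_mult_cancel:
  assumes "x \<in> carrier G" "y \<in> carrier G"
  shows "inv x \<otimes> (x \<otimes> y) = y" "x \<otimes> (inv x \<otimes> y) = y"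
  using assms by (simp_all flip: m_assoc)

lemma (in group) commutator_closed [simp]:
  "g \<in> carrier G \<Longrightarrow> h \<in> carrier G \<Longrightarrow> commutator G g h \<in> carrier G"
  by (simp add: commutator_def)

lemma (in group) inv_commutator:
  assumes "g \<in> carrier G" "h \<in> carrier G"
  shows "inv (commutator G g h) = commutator G h g"
  using assms by (simp add: commutator_def inv_mult_group m_assoc)

lemma (in group) commutator_swap_mem_iff:
  assumes "subgroup K G" "g \<in> carrier G" "h \<in> carrier G"
  shows "commutator G g h \<in> K \<longleftrightarrow> commutator G h g \<in> K"
  using assms by (metis inv_commutator subgroup.m_inv_closed)

text \<open>
  This is the preimage in \<open>G\<close> of the centralizer, in \<open>G/K\<close>, of the image of \<open>S\<close>, hence normal
  because the image of \<open>S\<close> is invariant under conjugation.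
\<close>

lemma (in group) centralizer_modulo_normal:
  assumes K: "K \<lhd> G" and S: "S \<subseteq> carrier G"
    and conj: "\<And>x s. x \<in> carrier G \<Longrightarrow> s \<in> S \<Longrightarrow> inv x \<otimes> s \<otimes> x \<in> S"
  shows "{g \<in> carrier G. \<forall>s\<in>S. commutator G g s \<in> K} \<lhd> G" (is "?C \<lhd> G")
proof (rule normal_invI)
  interpret K: normal K G by fact
  show "subgroup ?C G"
  proof (rule subgroupI)
    have "\<one> \<in> ?C"
      using S K.one_closed by (auto simp: commutator_def)
    then show "?C \<noteq> {}" by blast
  next
    fix a assume a: "a \<in> ?C"
    have "commutator G (inv a) s \<in> K" if s: "s \<in> S" for s
    proof -
      have c: "a \<in> carrier G" "s \<in> carrier G" using a s S by auto
      have "commutator G (inv a) s = a \<otimes> commutator G s a \<otimes> inv a"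
        using c by (simp add: commutator_def m_assoc)
      moreover have "commutator G s a \<in> K"
        using a s c K.subgroup_axioms commutator_swap_mem_iff by blast
      ultimately show ?thesis using K.inv_op_closed2 c by simp
    qed
    then show "inv a \<in> ?C" using a by simp
  next
    fix a b assume a: "a \<in> ?C" and b: "b \<in> ?C"
    have "commutator G (a \<otimes> b) s \<in> K" if s: "s \<in> S" for s
    proof -
      have c: "a \<in> carrier G" "b \<in> carrier G" "s \<in> carrier G" using a b s S by auto
      have "commutator G (a \<otimes> b) s = (inv b \<otimes> commutator G a s \<otimes> b) \<otimes> commutator G b s"
        using c by (simp add: commutator_def m_assoc inv_mult_group inv_mult_cancel)
      then show ?thesis using a b s c K.inv_op_closed1 by simp
    qed
    then show "a \<otimes> b \<in> ?C" using a b by simp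
  qed auto
next
  interpret K: normal K G by fact
  fix x a assume x: "x \<in> carrier G" and a: "a \<in> ?C"
  have "commutator G (x \<otimes> a \<otimes> inv x) s \<in> K" if s: "s \<in> S" for s
  proof -
    have c: "a \<in> carrier G" "s \<in> carrier G" using a s S by auto
    have "commutator G (x \<otimes> a \<otimes> inv x) s = x \<otimes> commutator G a (inv x \<otimes> s \<otimes> x) \<otimes> inv x"
      using c x by (simp add: commutator_def m_assoc inv_mult_group inv_mult_cancel)
    then show ?thesis using a s x c conj K.inv_op_closed2 by simp
  qed
  then show "x \<otimes> a \<otimes> inv x \<in> ?C" using a x by simp
qed

section \<open>Values of outer commutators on normal subgroups\<close>

definition word_values ::
    "('a, 'b) monoid_scheme \<Rightarrow> group_word \<Rightarrow> (nat \<Rightarrow> 'a set) \<Rightarrow> 'a set" where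
  "word_values G w A = {word_eval G \<rho> w | \<rho>. \<forall>i\<in>letters w. \<rho> i \<in> A i}"

lemma letters_simps [simp]:
  "letters [] = {}" "letters (a # u) = insert (fst a) (letters u)"
  "letters (u @ v) = letters u \<union> letters v"
  by (auto simp: letters_def)

lemma letters_word_inv [simp]: "letters (word_inv u) = letters u"
  by (force simp: letters_def word_inv_def image_iff)

lemma letters_word_comm [simp]: "letters (word_comm u v) = letters u \<union> letters v"
  by (auto simp: word_comm_def)

lemma finite_letters [simp]: "finite (letters u)"
  by (simp add: letters_def)

lemma card_letters_outer_commutator:
  "outer_commutator t w \<Longrightarrow> card (letters w) = t"
  by (induction rule: outer_commutator.induct) (auto simp: card_Un_disjoint)

lemma outer_commutator_weight_pos: "outer_commutator t w \<Longrightarrow> t \<ge> 1"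
  by (induction rule: outer_commutator.induct) auto

lemma word_eval_cong:
  "(\<And>i. i \<in> letters w \<Longrightarrow> \<rho> i = \<sigma> i) \<Longrightarrow> word_eval G \<rho> w = word_eval G \<sigma> w"
  by (induction w) auto

lemma word_values_mono:
  "(\<And>i. i \<in> letters w \<Longrightarrow> A i \<subseteq> B i) \<Longrightarrow> word_values G w A \<subseteq> word_values G w B"
  by (fastforce simp: word_values_def)

lemma word_values_cong:
  "(\<And>i. i \<in> letters w \<Longrightarrow> A i = B i) \<Longrightarrow> word_values G w A = word_values G w B"
  by (simp add: word_values_def)

lemma word_values_letter: "group G \<Longrightarrow> A i \<subseteq> carrier G \<Longrightarrow> word_values G [(i, True)] A = A i"
  by (force simp: word_values_def group.is_monoid subset_iff)

lemma (in group) word_eval_closed: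
  "\<forall>i \<in> letters w. \<rho> i \<in> carrier G \<Longrightarrow> word_eval G \<rho> w \<in> carrier G"
  by (induction w) auto

lemma (in group) word_eval_append:
  "\<forall>i \<in> letters u \<union> letters v. \<rho> i \<in> carrier G \<Longrightarrow>
    word_eval G \<rho> (u @ v) = word_eval G \<rho> u \<otimes> word_eval G \<rho> v"
  by (induction u) (auto simp: m_assoc word_eval_closed)

lemma (in group) word_eval_word_inv:
  "\<forall>i \<in> letters u. \<rho> i \<in> carrier G \<Longrightarrow>
    word_eval G \<rho> (word_inv u) = inv (word_eval G \<rho> u)"
proof (induction u)
  case Nil
  then show ?case by (simp add: word_inv_def)
next
  case (Cons a u)
  have "word_inv (a # u) = word_inv u @ [(fst a, \<not> snd a)]"
    by (simp add: word_inv_def case_prod_beta)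
  then show ?case
    using Cons by (auto simp: word_eval_append inv_mult_group word_eval_closed)
qed

lemma (in group) word_eval_word_comm:
  assumes "\<forall>i \<in> letters u \<union> letters v. \<rho> i \<in> carrier G"
  shows "word_eval G \<rho> (word_comm u v) = commutator G (word_eval G \<rho> u) (word_eval G \<rho> v)"
  using assms by (simp add: word_comm_def word_eval_append word_eval_word_inv word_eval_closed
      commutator_def ball_Un)

lemma (in group) word_values_subset_carrier:
  "(\<And>i. i \<in> letters w \<Longrightarrow> A i \<subseteq> carrier G) \<Longrightarrow> word_values G w A \<subseteq> carrier G"
  by (force simp: word_values_def intro!: word_eval_closed)

text \<open>Disjointness of the letters is what allows the two entries to be chosen independently.\<close>

lemma (in group) word_values_word_comm:
  assumes "letters u \<inter> letters v = {}" "\<And>i. A i \<subseteq> carrier G"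
  shows "word_values G (word_comm u v) A =
    {commutator G g h | g h. g \<in> word_values G u A \<and> h \<in> word_values G v A}" (is "?L = ?R")
proof
  show "?L \<subseteq> ?R"
  proof
    fix x assume "x \<in> ?L"
    then obtain \<rho> where \<rho>: "\<And>i. i \<in> letters u \<union> letters v \<Longrightarrow> \<rho> i \<in> A i"
      and x: "x = word_eval G \<rho> (word_comm u v)"
      by (auto simp: word_values_def)
    have "x = commutator G (word_eval G \<rho> u) (word_eval G \<rho> v)"
      using \<rho> assms(2) unfolding x by (intro word_eval_word_comm) blast
    then show "x \<in> ?R" using \<rho> by (fastforce simp: word_values_def)
  qed
  show "?R \<subseteq> ?L"
  proof
    fix x assume "x \<in> ?R"
    then obtain \<rho> \<sigma> where \<rho>: "\<And>i. i \<in> letters u \<Longrightarrow> \<rho> i \<in> A i"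
      and \<sigma>: "\<And>i. i \<in> letters v \<Longrightarrow> \<sigma> i \<in> A i"
      and x: "x = commutator G (word_eval G \<rho> u) (word_eval G \<sigma> v)"
      by (auto simp: word_values_def)
    define \<tau> where "\<tau> i = (if i \<in> letters u then \<rho> i else \<sigma> i)" for i
    have \<tau>: "\<tau> i \<in> A i" if "i \<in> letters u \<union> letters v" for i
      using that \<rho> \<sigma> by (auto simp: \<tau>_def)
    have "word_eval G \<rho> u = word_eval G \<tau> u" "word_eval G \<sigma> v = word_eval G \<tau> v"
      using assms(1) by (auto simp: \<tau>_def intro!: word_eval_cong)
    moreover have "\<forall>i \<in> letters u \<union> letters v. \<tau> i \<in> carrier G"
      using \<tau> assms(2) by blast
    ultimately have "x = word_eval G \<tau> (word_comm u v)"
      using word_eval_word_comm[of u v \<tau>] unfolding x by simp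
    then show "x \<in> ?L" using \<tau> by (auto simp: word_values_def)
  qed
qed

lemma (in group) word_eval_conj:
  assumes "x \<in> carrier G" "\<forall>i \<in> letters w. \<rho> i \<in> carrier G"
  shows "word_eval G (\<lambda>i. inv x \<otimes> \<rho> i \<otimes> x) w = inv x \<otimes> word_eval G \<rho> w \<otimes> x"
  using assms(2)
proof (induction w)
  case Nil
  then show ?case using assms(1) by simp
next
  case (Cons a w)
  define p where "p = (if snd a then \<rho> (fst a) else inv \<rho> (fst a))"
  define e where "e = word_eval G \<rho> w"
  have c: "p \<in> carrier G" "e \<in> carrier G"
    using Cons.prems word_eval_closed by (auto simp: p_def e_def)
  have "word_eval G (\<lambda>i. inv x \<otimes> \<rho> i \<otimes> x) (a # w) = (inv x \<otimes> p \<otimes> x) \<otimes> (inv x \<otimes> e \<otimes> x)"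
    using Cons assms(1) by (simp add: p_def e_def inv_mult_group m_assoc)
  also have "\<dots> = inv x \<otimes> (p \<otimes> e) \<otimes> x"
    using c assms(1) by (simp add: m_assoc inv_mult_cancel)
  finally show ?case by (simp add: p_def e_def)
qed

lemma (in group) word_values_conj:
  assumes A: "\<And>i. A i \<lhd> G" and x: "x \<in> carrier G" and s: "s \<in> word_values G w A"
  shows "inv x \<otimes> s \<otimes> x \<in> word_values G w A"
proof -
  obtain \<rho> where \<rho>: "\<And>i. i \<in> letters w \<Longrightarrow> \<rho> i \<in> A i" and s': "s = word_eval G \<rho> w"
    using s by (auto simp: word_values_def)
  have c: "\<forall>i \<in> letters w. \<rho> i \<in> carrier G"
    using \<rho> subgroup.mem_carrier[OF normal_imp_subgroup[OF A]] by blast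
  have "inv x \<otimes> \<rho> i \<otimes> x \<in> A i" if "i \<in> letters w" for i
    using normal.inv_op_closed1[OF A x \<rho>[OF that]] .
  then show ?thesis
    unfolding s' word_values_def using word_eval_conj[OF x c, symmetric] by auto
qed

text \<open>
  The target \<open>K\<close> has to be an arbitrary normal subgroup for the induction to work: \<open>[u, v]\<close> takes
  values in \<open>K\<close> iff \<open>u\<close> takes values in the centralizer modulo \<open>K\<close> of the values of \<open>v\<close>, which is
  again normal, and symmetrically for \<open>v\<close>. The slot \<open>i\<close> occurs in at most one of the two halves.
\<close>

lemma (in group) word_values_set_mult_slot:
  assumes "outer_commutator t w" "K \<lhd> G" "\<And>i. A i \<lhd> G" "B \<lhd> G" "C \<lhd> G"
    and "word_values G w (A(i := B)) \<subseteq> K" "word_values G w (A(i := C)) \<subseteq> K"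
  shows "word_values G w (A(i := B <#> C)) \<subseteq> K"
  using assms
proof (induction arbitrary: K rule: outer_commutator.induct)
  case (letter k K)
  have BC: "B <#> C \<lhd> G" using letter normal_subgroup_set_mult_closed by blast
  have car: "\<And>N. N \<lhd> G \<Longrightarrow> N \<subseteq> carrier G"
    by (simp add: normal_imp_subgroup subgroup.subset)
  have nrm: "(A(i := T)) k \<lhd> G" if "T \<lhd> G" for T
    using that letter.prems by simp
  have val: "word_values G [(k, True)] (A(i := T)) = (A(i := T)) k" if "T \<lhd> G" for T
    using car[OF nrm[OF that]] by (intro word_values_letter is_group)
  have "(A(i := B)) k \<subseteq> K" "(A(i := C)) k \<subseteq> K"
    using letter.prems(5,6)
    unfolding val[OF letter.prems(3)] val[OF letter.prems(4)] .
  then have "(A(i := B <#> C)) k \<subseteq> K"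
    using subgroup.m_closed[OF normal_imp_subgroup[OF letter.prems(1)]]
    by (auto simp: set_mult_def subset_iff split: if_splits)
  then show ?case unfolding val[OF BC] .
next
  case (comm r u s v K)
  have BC: "B <#> C \<lhd> G" using comm.prems normal_subgroup_set_mult_closed by blast
  have K: "subgroup K G" using comm.prems normal_imp_subgroup by blast
  have car: "\<And>N. N \<lhd> G \<Longrightarrow> N \<subseteq> carrier G"
    by (simp add: normal_imp_subgroup subgroup.subset)
  have nrm: "(A(i := T)) k \<lhd> G" if "T \<lhd> G" for T k
    using that comm.prems by simp
  have vals: "word_values G z (A(i := T)) \<subseteq> carrier G" if "T \<lhd> G" for T z
    using word_values_subset_carrier car nrm[OF that] by meson
  have split: "word_values G (word_comm u v) (A(i := T)) =
      {commutator G g h | g h. g \<in> word_values G u (A(i := T)) \<and> h \<in> word_values G v (A(i := T))}"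
    if "T \<lhd> G" for T
    using word_values_word_comm[OF comm.hyps(3)] car nrm[OF that] by meson
  consider "i \<notin> letters v" | "i \<notin> letters u" using comm.hyps(3) by blast
  then show ?case
  proof cases
    case 1
    define S where "S = word_values G v A"
    have S: "word_values G v (A(i := T)) = S" for T
      unfolding S_def using 1 by (intro word_values_cong) auto
    define L where "L = {g \<in> carrier G. \<forall>s\<in>S. commutator G g s \<in> K}"
    have "L \<lhd> G" unfolding L_def
    proof (rule centralizer_modulo_normal)
      show "S \<subseteq> carrier G" using vals[OF comm.prems(3), of v] S by simp
      show "inv x \<otimes> s \<otimes> x \<in> S" if "x \<in> carrier G" "s \<in> S" for x s
        using that word_values_conj comm.prems(2) unfolding S_def by blast
    qed (rule comm.prems)
    moreover have iff: "word_values G (word_comm u v) (A(i := T)) \<subseteq> K \<longleftrightarrow>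
        word_values G u (A(i := T)) \<subseteq> L" if "T \<lhd> G" for T
      unfolding split[OF that] S L_def using vals[OF that, of u] by blast
    ultimately have "word_values G u (A(i := B <#> C)) \<subseteq> L"
      using comm.IH(1)[of L] comm.prems by blast
    then show ?thesis using iff[OF BC] by blast
  next
    case 2
    define S where "S = word_values G u A"
    have S: "word_values G u (A(i := T)) = S" for T
      unfolding S_def using 2 by (intro word_values_cong) auto
    have Sc: "S \<subseteq> carrier G" using vals[OF comm.prems(3), of u] S by simp
    define L where "L = {g \<in> carrier G. \<forall>s\<in>S. commutator G g s \<in> K}"
    have "L \<lhd> G" unfolding L_def
    proof (rule centralizer_modulo_normal)
      show "inv x \<otimes> s \<otimes> x \<in> S" if "x \<in> carrier G" "s \<in> S" for x s
        using that word_values_conj comm.prems(2) unfolding S_def by blast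
    qed (rule comm.prems Sc)+
    moreover have iff: "word_values G (word_comm u v) (A(i := T)) \<subseteq> K \<longleftrightarrow>
        word_values G v (A(i := T)) \<subseteq> L" if "T \<lhd> G" for T
    proof -
      have "commutator G g h \<in> K \<longleftrightarrow> commutator G h g \<in> K"
        if "g \<in> S" "h \<in> word_values G v (A(i := T))" for g h
        using that Sc vals[OF \<open>T \<lhd> G\<close>, of v] commutator_swap_mem_iff[OF K] by blast
      then show ?thesis
        unfolding split[OF that] S L_def using vals[OF that, of v] by blast
    qed
    ultimately have "word_values G v (A(i := B <#> C)) \<subseteq> L"
      using comm.IH(2)[of L] comm.prems by blast
    then show ?thesis using iff[OF BC] by blast
  qed
qed

text \<open>
  Expanding the product in every slot of \<open>S\<close>; a term of the expansion is given by the set \<open>I\<close> of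
  slots in which \<open>B\<close> is chosen.
\<close>

lemma (in group) word_values_set_mult:
  assumes w: "outer_commutator t w" and K: "K \<lhd> G" and B: "B \<lhd> G" and C: "C \<lhd> G"
    and "finite S" and "\<And>i. A i \<lhd> G"
    and "\<And>I. I \<subseteq> S \<Longrightarrow>
      word_values G w (\<lambda>i. if i \<in> I then B else if i \<in> S then C else A i) \<subseteq> K"
  shows "word_values G w (\<lambda>i. if i \<in> S then B <#> C else A i) \<subseteq> K"
  using assms(5-7)
proof (induction arbitrary: A rule: finite_induct)
  case empty
  then show ?case using empty.prems(2)[of "{}"] by simp
next
  case (insert s S)
  have BC: "B <#> C \<lhd> G" using B C normal_subgroup_set_mult_closed by blast
  have "word_values G w (\<lambda>i. if i \<in> S then B <#> C else (A(s := B <#> C)) i) \<subseteq> K"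
  proof (rule insert.IH)
    show "\<And>i. (A(s := B <#> C)) i \<lhd> G" using BC insert.prems(1) by simp
  next
    fix I assume I: "I \<subseteq> S"
    define T where "T = (\<lambda>i. if i \<in> I then B else if i \<in> S then C else A i)"
    have "T(s := B) = (\<lambda>i. if i \<in> insert s I then B else if i \<in> insert s S then C else A i)"
      "T(s := C) = (\<lambda>i. if i \<in> I then B else if i \<in> insert s S then C else A i)"
      "T(s := B <#> C) =
        (\<lambda>i. if i \<in> I then B else if i \<in> S then C else (A(s := B <#> C)) i)"
      using I insert.hyps(2) unfolding T_def by (auto simp: fun_eq_iff)
    moreover have "word_values G w (T(s := B <#> C)) \<subseteq> K"
    proof (rule word_values_set_mult_slot[OF w K _ B C])
      show "T i \<lhd> G" for i using B C insert.prems(1) by (simp add: T_def)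
      show "word_values G w (T(s := B)) \<subseteq> K" "word_values G w (T(s := C)) \<subseteq> K"
        unfolding calculation using insert.prems(2)[of "insert s I"] insert.prems(2)[of I] I by auto
    qed
    ultimately show "word_values G w
        (\<lambda>i. if i \<in> I then B else if i \<in> S then C else (A(s := B <#> C)) i) \<subseteq> K"
      by simp
  qed
  also have "(\<lambda>i. if i \<in> S then B <#> C else (A(s := B <#> C)) i) =
      (\<lambda>i. if i \<in> insert s S then B <#> C else A i)"
    by (auto simp: fun_eq_iff)
  finally show ?case .
qed

lemma (in group) satisfies_identity_iff_word_values:
  assumes N: "subgroup N G"
  shows "satisfies_identity (G\<lparr>carrier := N\<rparr>) w \<longleftrightarrow> word_values G w (\<lambda>_. N) \<subseteq> {\<one>}"
proof -
  have eval: "word_eval (G\<lparr>carrier := N\<rparr>) \<rho> u = word_eval G \<rho> u"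
    if "\<forall>i. \<rho> i \<in> N" for \<rho> u
    using that N by (induction u) auto
  have "word_values G w (\<lambda>_. N) = {word_eval G \<rho> w | \<rho>. \<forall>i. \<rho> i \<in> N}" (is "?L = ?R")
  proof
    show "?L \<subseteq> ?R"
    proof
      fix x assume "x \<in> ?L"
      then obtain \<rho> where \<rho>: "\<forall>i\<in>letters w. \<rho> i \<in> N" "x = word_eval G \<rho> w"
        by (auto simp: word_values_def)
      define \<sigma> where "\<sigma> i = (if i \<in> letters w then \<rho> i else \<one>)" for i
      have "x = word_eval G \<sigma> w"
        using \<rho>(2) by (auto simp: \<sigma>_def intro!: word_eval_cong)
      moreover have "\<forall>i. \<sigma> i \<in> N"
        using \<rho>(1) subgroup.one_closed[OF N] by (simp add: \<sigma>_def)
      ultimately show "x \<in> ?R" by blast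
    qed
  qed (auto simp: word_values_def)
  then show ?thesis by (auto simp: satisfies_identity_def eval)
qed

lemma (in group) normal_subgroups_satisfying_iff:
  "N \<in> normal_subgroups_satisfying G w \<longleftrightarrow> N \<lhd> G \<and> word_values G w (\<lambda>_. N) \<subseteq> {\<one>}"
  using satisfies_identity_iff_word_values[OF normal_imp_subgroup]
  by (auto simp only: normal_subgroups_satisfying_def mem_Collect_eq)

section \<open>Counting cosets\<close>

lemma (in group) rcosets_Int:
  assumes A: "subgroup A G" and B: "subgroup B G"
  shows "rcosets (A \<inter> B) \<subseteq> (\<lambda>p. fst p \<inter> snd p) ` ((rcosets A) \<times> (rcosets B))"
proof
  fix T assume "T \<in> rcosets (A \<inter> B)"
  then obtain g where g: "g \<in> carrier G" "T = (A \<inter> B) #> g" by (auto simp: RCOSETS_def)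
  have "T = (A #> g) \<inter> (B #> g)"
  proof
    show "(A #> g) \<inter> (B #> g) \<subseteq> T"
    proof
      fix y assume "y \<in> (A #> g) \<inter> (B #> g)"
      then obtain a b where ab: "a \<in> A" "b \<in> B" "y = a \<otimes> g" "y = b \<otimes> g"
        by (auto simp: r_coset_def)
      then have "a = b" using g A B by (metis r_cancel subgroup.mem_carrier)
      then show "y \<in> T" using ab g by (auto simp: r_coset_def)
    qed
  qed (auto simp: g r_coset_def)
  then show "T \<in> (\<lambda>p. fst p \<inter> snd p) ` ((rcosets A) \<times> (rcosets B))"
    using g(1) by (intro image_eqI[of _ _ "(A #> g, B #> g)"]) (auto simp: RCOSETS_def)
qed

lemma (in group) index_Int:
  assumes "subgroup A G" "subgroup B G" "finite (rcosets A)" "finite (rcosets B)"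
  shows "finite (rcosets (A \<inter> B))"
    and "card (rcosets (A \<inter> B)) \<le> card (rcosets A) * card (rcosets B)"
proof -
  have fin: "finite ((rcosets A) \<times> (rcosets B))" using assms by simp
  show "finite (rcosets (A \<inter> B))"
    using finite_subset[OF rcosets_Int] fin assms by blast
  show "card (rcosets (A \<inter> B)) \<le> card (rcosets A) * card (rcosets B)"
    using surj_card_le[OF fin rcosets_Int[OF assms(1,2)]] by (simp add: card_cartesian_product)
qed

lemma (in group) index_Int_Inter:
  assumes "finite \<F>" "Z \<lhd> G" "finite (rcosets Z)"
    and "\<And>N. N \<in> \<F> \<Longrightarrow> N \<lhd> G \<and> finite (rcosets N)"
  shows "Z \<inter> \<Inter>\<F> \<lhd> G \<and> finite (rcosets (Z \<inter> \<Inter>\<F>)) \<and>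
    (\<forall>n. (\<forall>N\<in>\<F>. card (rcosets N) \<le> n) \<longrightarrow>
      card (rcosets (Z \<inter> \<Inter>\<F>)) \<le> card (rcosets Z) * n ^ card \<F>)"
  using assms(1,4)
proof (induction rule: finite_induct)
  case empty
  then show ?case using assms(2,3) by simp
next
  case (insert N \<F>)
  define Y where "Y = Z \<inter> \<Inter>\<F>"
  have Y: "Y \<lhd> G" "finite (rcosets Y)"
    and b: "\<And>n. \<forall>N\<in>\<F>. card (rcosets N) \<le> n \<Longrightarrow>
      card (rcosets Y) \<le> card (rcosets Z) * n ^ card \<F>"
    using insert unfolding Y_def by auto
  have N: "N \<lhd> G" "finite (rcosets N)" using insert.prems by auto
  have eq: "Z \<inter> \<Inter>(insert N \<F>) = Y \<inter> N" unfolding Y_def by auto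
  have "card (rcosets (Y \<inter> N)) \<le> card (rcosets Z) * n ^ card (insert N \<F>)"
    if n: "\<forall>N\<in>insert N \<F>. card (rcosets N) \<le> n" for n
  proof -
    have "card (rcosets (Y \<inter> N)) \<le> card (rcosets Y) * card (rcosets N)"
      using index_Int Y N normal_imp_subgroup by blast
    also have "\<dots> \<le> (card (rcosets Z) * n ^ card \<F>) * n"
      using b[of n] n by (intro mult_le_mono) auto
    finally show ?thesis using insert.hyps by (simp add: mult_ac)
  qed
  moreover have "Y \<inter> N \<lhd> G" using Y N normal_subgroup_intersect by blast
  moreover have "finite (rcosets (Y \<inter> N))"
    using index_Int Y N normal_imp_subgroup by blast
  ultimately show ?case unfolding eq by blast
qed

text \<open>A subgroup above \<open>Z\<close> is determined by the set of cosets of \<open>Z\<close> that it contains.\<close>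

lemma (in group) card_subgroups_above:
  assumes Z: "subgroup Z G" and fin: "finite (rcosets Z)"
    and \<H>: "\<And>H. H \<in> \<H> \<Longrightarrow> subgroup H G \<and> Z \<subseteq> H"
  shows "finite \<H> \<and> card \<H> \<le> 2 ^ card (rcosets Z)"
proof -
  have "\<Union>{T \<in> rcosets Z. T \<subseteq> H} = H" if "H \<in> \<H>" for H
  proof
    show "H \<subseteq> \<Union>{T \<in> rcosets Z. T \<subseteq> H}"
    proof
      fix h assume h: "h \<in> H"
      have H: "subgroup H G" "Z \<subseteq> H" using \<H> that by auto
      have hc: "h \<in> carrier G" using subgroup.mem_carrier[OF H(1) h] .
      have "Z #> h \<subseteq> H"
        using H(2) h subgroup.m_closed[OF H(1)] by (auto simp: r_coset_def)
      moreover have "h \<in> Z #> h" using rcos_self[OF hc Z] .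
      moreover have "Z #> h \<in> rcosets Z" using rcosetsI[OF subgroup.subset[OF Z] hc] .
      ultimately show "h \<in> \<Union>{T \<in> rcosets Z. T \<subseteq> H}" by blast
    qed
  qed blast
  then have sub: "\<H> \<subseteq> Union ` Pow (rcosets Z)"
    by (intro subsetI image_eqI[of _ Union "{T \<in> rcosets Z. T \<subseteq> _}"]) auto
  have P: "finite (Pow (rcosets Z))" using fin by simp
  have "finite \<H>" using finite_subset[OF sub] P by blast
  moreover have "card \<H> \<le> card (Pow (rcosets Z))"
    using surj_card_le[OF P sub] .
  ultimately show ?thesis using fin by (simp add: card_Pow)
qed

lemma (in group) subset_set_mult:
  assumes "subgroup M G" "subgroup N G"
  shows "M \<subseteq> M <#> N" "N \<subseteq> M <#> N"
proof -
  have "m = m \<otimes> \<one>" if "m \<in> M" for m using assms that subgroup.mem_carrier by fastforce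
  then show "M \<subseteq> M <#> N"
    using assms subgroup.one_closed unfolding set_mult_def by blast
  have "n = \<one> \<otimes> n" if "n \<in> N" for n using assms that subgroup.mem_carrier by fastforce
  then show "N \<subseteq> M <#> N"
    using assms subgroup.one_closed unfolding set_mult_def by blast
qed

section \<open>A finite-index subgroup inside all maximal ones\<close>

definition mixed_vanishing ::
    "('a, 'b) monoid_scheme \<Rightarrow> group_word \<Rightarrow> 'a set set \<Rightarrow> nat \<Rightarrow> 'a set \<Rightarrow> bool" where
  "mixed_vanishing G w \<M> j Z \<longleftrightarrow>
     (\<forall>N\<in>\<M>. \<forall>J\<subseteq>letters w. j \<le> card J \<longrightarrow>
        word_values G w (\<lambda>i. if i \<in> J then Z else N) \<subseteq> {\<one>\<^bsub>G\<^esub>})"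

text \<open>
  Let \<open>M\<close> represent the class \<open>N Z = M Z\<close>, and let \<open>j\<close> slots hold \<open>Z' \<subseteq> Z \<inter> M\<close>. Replacing
  the remaining entries \<open>N\<close> by the larger \<open>M Z\<close> and expanding gives terms with at least \<open>j + 1\<close>
  entries below \<open>Z\<close> and the rest equal to \<open>M\<close>, and the one term with all entries below \<open>M\<close>.
\<close>

lemma (in group) mixed_vanishing_step:
  assumes w: "outer_commutator t w"
    and \<M>: "\<And>N. N \<in> \<M> \<Longrightarrow> N \<lhd> G \<and> finite (rcosets N) \<and> word_values G w (\<lambda>_. N) \<subseteq> {\<one>}"
    and Z: "Z \<lhd> G" "finite (rcosets Z)" "mixed_vanishing G w \<M> (Suc j) Z"
  shows "\<exists>Z'. Z' \<lhd> G \<and> finite (rcosets Z') \<and> mixed_vanishing G w \<M> j Z' \<and>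
    (\<forall>n\<ge>1. (\<forall>N\<in>\<M>. card (rcosets N) \<le> n) \<longrightarrow>
      card (rcosets Z') \<le> card (rcosets Z) * n ^ (2 ^ card (rcosets Z)))"
proof -
  define \<C> where "\<C> = (\<lambda>N. N <#> Z) ` \<M>"
  have "finite \<C> \<and> card \<C> \<le> 2 ^ card (rcosets Z)"
  proof (rule card_subgroups_above)
    show "subgroup Z G" using Z normal_imp_subgroup by blast
    show "subgroup H G \<and> Z \<subseteq> H" if H: "H \<in> \<C>" for H
    proof -
      obtain N where N: "N \<lhd> G" "H = N <#> Z" using H \<M> unfolding \<C>_def by blast
      have "N <#> Z \<lhd> G" using N Z(1) normal_subgroup_set_mult_closed by simp
      then show ?thesis
        using N Z(1) by (simp add: normal_imp_subgroup subset_set_mult(2))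
    qed
  qed (rule Z)
  then have \<C>: "finite \<C>" "card \<C> \<le> 2 ^ card (rcosets Z)" by auto
  define rep where "rep c = (SOME N. N \<in> \<M> \<and> N <#> Z = c)" for c
  have rep: "rep c \<in> \<M> \<and> rep c <#> Z = c" if "c \<in> \<C>" for c
    using that someI_ex[of "\<lambda>N. N \<in> \<M> \<and> N <#> Z = c"] unfolding rep_def \<C>_def by blast
  define \<F> where "\<F> = rep ` \<C>"
  have \<F>: "finite \<F>" "\<F> \<subseteq> \<M>" "card \<F> \<le> 2 ^ card (rcosets Z)"
    using \<C> rep card_image_le[OF \<C>(1), of rep] unfolding \<F>_def by auto
  define Z' where "Z' = Z \<inter> \<Inter>\<F>"
  have "\<And>N. N \<in> \<F> \<Longrightarrow> N \<lhd> G \<and> finite (rcosets N)" using \<F>(2) \<M> by blast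
  from index_Int_Inter[OF \<F>(1) Z(1,2) this]
  have Z': "Z' \<lhd> G" "finite (rcosets Z')"
    and bound: "\<And>n. \<forall>N\<in>\<F>. card (rcosets N) \<le> n \<Longrightarrow>
      card (rcosets Z') \<le> card (rcosets Z) * n ^ card \<F>"
    unfolding Z'_def by blast+
  have "mixed_vanishing G w \<M> j Z'"
    unfolding mixed_vanishing_def
  proof (intro ballI allI impI)
    fix N J assume N: "N \<in> \<M>" and J: "J \<subseteq> letters w" "j \<le> card J"
    define M where "M = rep (N <#> Z)"
    have "N <#> Z \<in> \<C>" using N unfolding \<C>_def by blast
    then have M: "M \<in> \<M>" "M <#> Z = N <#> Z" "Z' \<subseteq> M"
      using rep unfolding M_def Z'_def \<F>_def by auto
    have nM: "M \<lhd> G" "N \<lhd> G" using M(1) N \<M> by auto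
    have comm: "M <#> Z = Z <#> M"
      using commut_normal[OF normal_imp_subgroup[OF nM(1)] Z(1)] by simp
    define S where "S = letters w - J"
    have "word_values G w (\<lambda>i. if i \<in> J then Z' else N) \<subseteq>
        word_values G w (\<lambda>i. if i \<in> S then Z <#> M else Z')"
      using subset_set_mult(1)[OF normal_imp_subgroup normal_imp_subgroup] nM Z(1) M(2) comm
      by (intro word_values_mono) (auto simp: S_def)
    also have "\<dots> \<subseteq> {\<one>}"
    proof (rule word_values_set_mult[OF w _ Z(1) nM(1)])
      show "{\<one>} \<lhd> G" by (rule one_is_normal)
      show "finite S" by (simp add: S_def)
      show "Z' \<lhd> G" by fact
      fix I assume I: "I \<subseteq> S"
      show "word_values G w (\<lambda>i. if i \<in> I then Z else if i \<in> S then M else Z') \<subseteq> {\<one>}"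
      proof (cases "I = {}")
        case True
        have "word_values G w (\<lambda>i. if i \<in> I then Z else if i \<in> S then M else Z') \<subseteq>
            word_values G w (\<lambda>_. M)"
          using True M(3) by (intro word_values_mono) auto
        then show ?thesis using \<M>[OF M(1)] by blast
      next
        case False
        have fin: "finite J" "finite I"
          using J(1) I finite_subset[OF _ finite_letters] unfolding S_def by blast+
        have "card (J \<union> I) = card J + card I"
          using I fin by (intro card_Un_disjoint) (auto simp: S_def)
        moreover have "card I \<ge> 1" using False fin by (simp add: Suc_le_eq card_gt_0_iff)
        ultimately have "Suc j \<le> card (J \<union> I)" using J by simp
        moreover have "J \<union> I \<subseteq> letters w" using I J by (auto simp: S_def)
        ultimately have "word_values G w (\<lambda>i. if i \<in> J \<union> I then Z else M) \<subseteq> {\<one>}"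
          using Z(3) M(1) unfolding mixed_vanishing_def by blast
        moreover have "word_values G w (\<lambda>i. if i \<in> I then Z else if i \<in> S then M else Z') \<subseteq>
            word_values G w (\<lambda>i. if i \<in> J \<union> I then Z else M)"
          using I by (intro word_values_mono) (auto simp: S_def Z'_def)
        ultimately show ?thesis by blast
      qed
    qed
    finally show "word_values G w (\<lambda>i. if i \<in> J then Z' else N) \<subseteq> {\<one>}" .
  qed
  moreover have "card (rcosets Z') \<le> card (rcosets Z) * n ^ (2 ^ card (rcosets Z))"
    if n: "n \<ge> 1" "\<forall>N\<in>\<M>. card (rcosets N) \<le> n" for n
  proof -
    have "card (rcosets Z') \<le> card (rcosets Z) * n ^ card \<F>" using bound n \<F>(2) by blast
    also have "\<dots> \<le> card (rcosets Z) * n ^ (2 ^ card (rcosets Z))"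
      using n \<F>(3) by (intro mult_le_mono power_increasing) auto
    finally show ?thesis .
  qed
  ultimately show ?thesis using Z' by blast
qed

text \<open>
  The bound is uniform in \<open>n\<close> because \<open>Z\<close> is constructed without reference to \<open>n\<close>; with no
  common bound on the indices the statement still gives a subgroup of finite index.
\<close>

lemma (in group) mixed_vanishing_iterate:
  fixes w :: group_word and \<M> :: "'a set set"
  assumes w: "outer_commutator t w" and ne: "\<M> \<noteq> {}"
    and \<M>: "\<And>N. N \<in> \<M> \<Longrightarrow> N \<lhd> G \<and> finite (rcosets N) \<and> word_values G w (\<lambda>_. N) \<subseteq> {\<one>}"
  shows "\<exists>Z. Z \<lhd> G \<and> finite (rcosets Z) \<and> mixed_vanishing G w \<M> (t - k) Z \<and>
    (\<forall>n\<ge>1. (\<forall>N\<in>\<M>. card (rcosets N) \<le> n) \<longrightarrow>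
      card (rcosets Z) \<le> ((\<lambda>x. x * n ^ (2 ^ x)) ^^ k) n)"
proof (induction k)
  case 0
  obtain N where N: "N \<in> \<M>" using ne by blast
  \<comment> \<open>At level \<open>t\<close> every slot holds \<open>N\<close>, so the condition is just the identity on \<open>N\<close>.\<close>
  have "mixed_vanishing G w \<M> t N"
    unfolding mixed_vanishing_def
  proof (intro ballI allI impI)
    fix M J assume "J \<subseteq> letters w" "t \<le> card J"
    then have "J = letters w"
      using card_seteq[OF finite_letters] card_letters_outer_commutator[OF w] by simp
    then have "word_values G w (\<lambda>i. if i \<in> J then N else M) = word_values G w (\<lambda>_. N)"
      by (intro word_values_cong) simp
    then show "word_values G w (\<lambda>i. if i \<in> J then N else M) \<subseteq> {\<one>}" using \<M>[OF N] by simp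
  qed
  then show ?case using N \<M>[OF N] by (intro exI[of _ N]) auto
next
  case (Suc k)
  then obtain Z where Z: "Z \<lhd> G" "finite (rcosets Z)" "mixed_vanishing G w \<M> (t - k) Z"
    and bZ: "\<And>n. n \<ge> 1 \<Longrightarrow> \<forall>N\<in>\<M>. card (rcosets N) \<le> n \<Longrightarrow>
      card (rcosets Z) \<le> ((\<lambda>x. x * n ^ (2 ^ x)) ^^ k) n"
    by blast
  have "mixed_vanishing G w \<M> (Suc (t - Suc k)) Z"
    unfolding mixed_vanishing_def
  proof (intro ballI allI impI)
    fix N J assume "N \<in> \<M>" "J \<subseteq> letters w" "Suc (t - Suc k) \<le> card J"
    moreover from this have "t - k \<le> card J" by simp
    ultimately show "word_values G w (\<lambda>i. if i \<in> J then Z else N) \<subseteq> {\<one>}"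
      using Z(3) unfolding mixed_vanishing_def by blast
  qed
  from mixed_vanishing_step[OF w \<M> Z(1,2) this]
  obtain Z' where Z': "Z' \<lhd> G" "finite (rcosets Z')" "mixed_vanishing G w \<M> (t - Suc k) Z'"
    and b: "\<And>n. n \<ge> 1 \<Longrightarrow> \<forall>N\<in>\<M>. card (rcosets N) \<le> n \<Longrightarrow>
      card (rcosets Z') \<le> card (rcosets Z) * n ^ (2 ^ card (rcosets Z))"
    by blast
  have "card (rcosets Z') \<le> ((\<lambda>x. x * n ^ (2 ^ x)) ^^ Suc k) n"
    if n: "n \<ge> 1" "\<forall>N\<in>\<M>. card (rcosets N) \<le> n" for n
  proof -
    let ?y = "((\<lambda>x. x * n ^ (2 ^ x)) ^^ k) n"
    have "card (rcosets Z') \<le> card (rcosets Z) * n ^ (2 ^ card (rcosets Z))" using b n by blast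
    also have "\<dots> \<le> ?y * n ^ (2 ^ ?y)"
      using n bZ[OF n] by (intro mult_le_mono power_increasing) auto
    finally show ?thesis by simp
  qed
  then show ?case using Z' by blast
qed

text \<open>
  Expanding \<open>w\<close> on \<open>Z N\<close>, every term containing \<open>Z\<close> vanishes by goodness at level \<open>1\<close> and the
  remaining one vanishes on \<open>N\<close>; so \<open>Z N\<close> competes with \<open>N\<close> and maximality gives \<open>Z N = N\<close>.
\<close>

lemma (in group) subgroup_below_maximal:
  assumes w: "outer_commutator t w" and \<M>: "\<M> \<subseteq> maximal_finite_index G w"
    and Z: "Z \<lhd> G" "mixed_vanishing G w \<M> 1 Z" and N: "N \<in> \<M>"
  shows "Z \<subseteq> N"
proof -
  have N': "N \<lhd> G" "word_values G w (\<lambda>_. N) \<subseteq> {\<one>}"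
    using \<M> N by (auto simp: maximal_finite_index_def normal_subgroups_satisfying_iff)
  have max: "M = N" if "M \<in> normal_subgroups_satisfying G w" "N \<subseteq> M" for M
    using that \<M> N unfolding maximal_finite_index_def by blast
  have ZN: "Z <#> N \<lhd> G" using Z N' normal_subgroup_set_mult_closed by blast
  have "word_values G w (\<lambda>i. if i \<in> letters w then Z <#> N else N) \<subseteq> {\<one>}"
  proof (rule word_values_set_mult[OF w one_is_normal Z(1) N'(1)])
    fix I assume I: "I \<subseteq> letters w"
    then have fin: "finite I" using finite_subset[OF _ finite_letters] by blast
    show "word_values G w (\<lambda>i. if i \<in> I then Z else if i \<in> letters w then N else N) \<subseteq> {\<one>}"
    proof (cases "I = {}")
      case True
      then show ?thesis using N'(2) by simp
    next
      case False
      then have "1 \<le> card I" using fin by (simp add: Suc_le_eq card_gt_0_iff)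
      then show ?thesis using Z(2) N I by (simp add: mixed_vanishing_def cong: if_cong)
    qed
  qed (use N' in auto)
  also have "word_values G w (\<lambda>i. if i \<in> letters w then Z <#> N else N) =
      word_values G w (\<lambda>_. Z <#> N)"
    by (intro word_values_cong) simp
  finally have "Z <#> N \<in> normal_subgroups_satisfying G w"
    using ZN normal_subgroups_satisfying_iff by simp
  then have "Z <#> N = N"
    using max subset_set_mult(2) Z(1) N'(1) normal_imp_subgroup by blast
  then show ?thesis
    using subset_set_mult(1) Z(1) N'(1) normal_imp_subgroup by blast
qed

text \<open>
  Arbitrary subfamilies serve both halves of the theorem: the family of all maximal subgroups gives
  finiteness, and the subfamily of those of index at most \<open>n\<close> gives the explicit bound.
\<close>

lemma (in group) maximal_family_bound:
  assumes w: "outer_commutator t w" and \<M>: "\<M> \<subseteq> maximal_finite_index G w"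
  shows "finite \<M> \<and> (\<forall>n\<ge>1. (\<forall>N\<in>\<M>. card (rcosets N) \<le> n) \<longrightarrow>
    card \<M> \<le> 2 ^ (((\<lambda>x. x * n ^ (2 ^ x)) ^^ (t - 1)) n))"
proof (cases "\<M> = {}")
  case False
  have \<M>': "N \<lhd> G \<and> finite (rcosets N) \<and> word_values G w (\<lambda>_. N) \<subseteq> {\<one>}" if "N \<in> \<M>" for N
    using that \<M> by (auto simp: maximal_finite_index_def normal_subgroups_satisfying_iff)
  have "t - (t - 1) = 1" using outer_commutator_weight_pos[OF w] by simp
  then obtain Z where Z: "Z \<lhd> G" "finite (rcosets Z)" "mixed_vanishing G w \<M> 1 Z"
    and b: "\<And>n. n \<ge> 1 \<Longrightarrow> \<forall>N\<in>\<M>. card (rcosets N) \<le> n \<Longrightarrow>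
      card (rcosets Z) \<le> ((\<lambda>x. x * n ^ (2 ^ x)) ^^ (t - 1)) n"
    using mixed_vanishing_iterate[OF w False \<M>', of "t - 1"] by auto
  have above: "finite \<M> \<and> card \<M> \<le> 2 ^ card (rcosets Z)"
  proof (rule card_subgroups_above)
    show "subgroup N G \<and> Z \<subseteq> N" if "N \<in> \<M>" for N
      using subgroup_below_maximal[OF w \<M> Z(1,3) that] \<M>'[OF that] normal_imp_subgroup by blast
  qed (use Z normal_imp_subgroup in auto)
  have "card \<M> \<le> 2 ^ (((\<lambda>x. x * n ^ (2 ^ x)) ^^ (t - 1)) n)"
    if "n \<ge> 1" "\<forall>N\<in>\<M>. card (rcosets N) \<le> n" for n
    using above power_increasing[OF b[OF that], of "2 :: nat"] by linarith
  then show ?thesis using above by blast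
qed simp

theorem mainTheorem5:
  fixes G :: "('a, 'b) monoid_scheme" and w :: group_word and t :: nat
  assumes "group G"
    and "outer_commutator t w"
  shows "finite (maximal_finite_index G w) \<and>
    (\<forall>n::nat. n \<ge> 1 \<longrightarrow>
      card {N \<in> maximal_finite_index G w. card (rcosets\<^bsub>G\<^esub> N) \<le> n}
        \<le> 2 ^ (((\<lambda>x. x * n ^ (2 ^ x)) ^^ (t - 1)) n))"
proof -
  interpret group G by fact
  have "finite (maximal_finite_index G w)"
    using maximal_family_bound[OF assms(2) order_refl] by blast
  moreover have "card {N \<in> maximal_finite_index G w. card (rcosets\<^bsub>G\<^esub> N) \<le> n}
      \<le> 2 ^ (((\<lambda>x. x * n ^ (2 ^ x)) ^^ (t - 1)) n)" if "n \<ge> 1" for n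
    using maximal_family_bound[OF assms(2),
        of "{N \<in> maximal_finite_index G w. card (rcosets\<^bsub>G\<^esub> N) \<le> n}"] that
    by auto
  ultimately show ?thesis by blast
qed

end
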